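(* Let $\mathcal{H}$ be a real Hilbert space and let $f:\mathcal{H}\to\mathbb{R}$ be convex and continuously differentiable with $L_{\nabla f}$-Lipschitz continuous gradient, $L_{\nabla f}>0$, and suppose that the set $\operatorname{argmin}_{\mathcal{H}} f$ of global minimizers of $f$ is nonempty. Let $0\le\theta<1$ and let $(t_k)_{k\ge 1}\subseteq(0,+\infty)$ be the sequence satisfying $$t_1=1\quad\text{and}\quad t_{k+1}^2-t_k^2=(1-\theta)\,t_{k+1}+\theta\, t_k\qquad\forall k\ge 1.$$ Let $0<\lambda\le \frac{1}{L_{\nabla f}}$, let $x_0,x_1\in\mathcal{H}$ be given, and let $(x_k)_{k\ge 0}$ be the sequence generated, for every $k\ge 1$, by $$y_k:=x_k+\alpha_k(x_k-x_{k-1}),\qquad x_{k+1}:=y_k-\lambda\nabla f(y_k),\qquad\text{where}\quad \alpha_k:=\frac{t_k-1}{t_{k+1}}.$$ Then the sequence $(x_k)_{k\ge 0}$ converges weakly in $\mathcal{H}$ to a minimizer of $f$, i.e. there exists $x_\star\in\operatorname{argmin}_{\mathcal{H}} f$ such that $\langle x_k,w\rangle\to\langle x_\star,w\rangle$ as $k\to+\infty$ for every $w\in\mathcal{H}$.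
   Context: $\mathcal{H}$ is a real Hilbert space (of arbitrary, possibly infinite, dimension) with scalar product $\langle\cdot,\cdot\rangle$ and associated norm $\|\cdot\|$. The gradient being $L_{\nabla f}$-Lipschitz means $\|\nabla f(x)-\nabla f(y)\|\le L_{\nabla f}\|x-y\|$ for all $x,y\in\mathcal{H}$. The positive sequence $(t_k)_{k\ge 1}$ is uniquely determined by the recursion, $t_{k+1}$ being the positive root of $t^2-(1-\theta)t-(t_k^2+\theta t_k)=0$. *)

theory Defs
  imports "HOL-Analysis.Analysis"
begin

definition argmin :: "('a \<Rightarrow> real) \<Rightarrow> 'a set"
  where "argmin f = {x. is_arg_min f (\<lambda>_. True) x}"

lemma argmin_iff: "x \<in> argmin f \<longleftrightarrow> (\<forall>y. f x \<le> f y)"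
  by (auto simp: argmin_def is_arg_min_linorder)

end

theory Submission
  imports Defs "HOL-Real_Asymp.Real_Asymp"
begin

text \<open>With \<open>v k = t k *\<^sub>R x k - (t k - 1) *\<^sub>R x (k - 1)\<close>, the energy
  \<open>E z k = 2 * lam * (t k)\<^sup>2 * (f (x k) - f z) + (norm (v k - z))\<^sup>2\<close> is nonincreasing for every
  minimizer \<open>z\<close>. This bounds the iterates and gives \<open>f (x k) \<longlonglongrightarrow> min f\<close>, so weak cluster points are
  minimizers. For two minimizers \<open>z\<close>, \<open>z'\<close> the function values cancel in \<open>E z k - E z' k\<close>; hence
  \<open>v k \<bullet> (z - z')\<close> converges, and so does \<open>x k \<bullet> (z - z')\<close>, which is an average of those
  numbers. Applied to two weak cluster points, this forces \<open>z = z'\<close>.\<close>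

section \<open>Weak compactness in Hilbert spaces\<close>

text \<open>Variational proof: if \<open>z\<close> represents \<open>\<phi>\<close>, then
  \<open>Q w\<close> equals \<open>(norm (w - z))\<^sup>2 - (norm z)\<^sup>2\<close>, so
  \<open>z\<close> is sought as the minimizer of \<open>Q\<close>. Completeness supplies it as the
  limit of a minimizing sequence.\<close>

lemma riesz_representation:
  fixes \<phi> :: "'a::{real_inner, complete_space} \<Rightarrow> real"
  assumes "bounded_linear \<phi>"
  shows "\<exists>z. \<forall>w. \<phi> w = z \<bullet> w"
proof -
  interpret \<phi>: bounded_linear \<phi> by fact
  define Q where "Q w = (norm w)\<^sup>2 - 2 * \<phi> w" for w
  obtain K where K: "\<And>w. norm (\<phi> w) \<le> norm w * K"
    using \<phi>.bounded by blast
  have lower: "Q w \<ge> - K\<^sup>2" for w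
  proof -
    have "Q w \<ge> (norm w)\<^sup>2 - 2 * (norm w * K)"
      using K[of w] unfolding Q_def real_norm_def by linarith
    moreover have "(norm w - K)\<^sup>2 \<ge> 0" by simp
    ultimately show ?thesis by (simp add: power2_diff)
  qed
  define m where "m = (INF w. Q w)"
  have bdd: "bdd_below (range Q)" using lower by (rule bdd_belowI2)
  have m_le: "m \<le> Q w" for w unfolding m_def using bdd by (auto intro: cINF_lower)
  have "\<exists>w. Q w < m + inverse (real (Suc n))" for n
    using cINF_less_iff[OF _ bdd, of "m + inverse (real (Suc n))"] by (auto simp: m_def)
  then obtain v where v: "\<And>n. Q (v n) < m + inverse (real (Suc n))" by metis
  \<comment> \<open>Comparing with the midpoint cancels the linear part of \<open>Q\<close>.
    Near-minimizers are therefore close to each other, which makes \<open>v\<close> Cauchy.\<close>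
  have parallelogram: "(norm (u - w))\<^sup>2 \<le> 2 * (Q u - m) + 2 * (Q w - m)" for u w
  proof -
    have "Q u + Q w - 2 * Q ((1/2) *\<^sub>R (u + w)) = (norm (u - w))\<^sup>2 / 2"
      unfolding Q_def power2_norm_eq_inner \<phi>.scale \<phi>.add
      by (simp add: algebra_simps inner_commute field_simps)
    moreover have "m \<le> Q ((1/2) *\<^sub>R (u + w))" by (rule m_le)
    ultimately show ?thesis by (simp add: field_simps)
  qed
  have "Cauchy v"
  proof (rule metric_CauchyI)
    fix e :: real assume e: "e > 0"
    then obtain N where N: "inverse (real (Suc N)) < e\<^sup>2 / 4"
      using reals_Archimedean[of "e\<^sup>2 / 4"] by auto
    have small: "Q (v n) - m < e\<^sup>2 / 4" if "n \<ge> N" for n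
    proof -
      have "inverse (real (Suc n)) \<le> inverse (real (Suc N))" using that by simp
      with v[of n] N show ?thesis by linarith
    qed
    have "dist (v i) (v j) < e" if "i \<ge> N" "j \<ge> N" for i j
    proof -
      have "(norm (v i - v j))\<^sup>2 < e\<^sup>2"
        using parallelogram[of "v i" "v j"] small[OF that(1)] small[OF that(2)]
        by (simp add: field_simps)
      then show ?thesis using e by (simp add: dist_norm power2_less_imp_less)
    qed
    then show "\<exists>M. \<forall>i\<ge>M. \<forall>j\<ge>M. dist (v i) (v j) < e" by blast
  qed
  then obtain z where z: "v \<longlonglongrightarrow> z"
    using Cauchy_convergent_iff convergent_def by blast
  have "(\<lambda>n. Q (v n)) \<longlonglongrightarrow> Q z"
    unfolding Q_def by (intro tendsto_intros z \<phi>.tendsto)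
  moreover have "(\<lambda>n. m + inverse (real (Suc n))) \<longlonglongrightarrow> m + 0"
    by (intro tendsto_intros LIMSEQ_inverse_real_of_nat)
  ultimately have "Q z \<le> m"
    using v by (intro LIMSEQ_le[of "\<lambda>n. Q (v n)" "Q z" "\<lambda>n. m + inverse (real (Suc n))"])
      (auto intro: less_imp_le)
  have "\<phi> w = z \<bullet> w" for w
  proof (rule ccontr)
    \<comment> \<open>First-order optimality along \<open>w\<close>: \<open>c\<close> is half the
      derivative of \<open>Q\<close> at \<open>z\<close> in direction \<open>w\<close>, and a step
      \<open>s\<close> against its sign would push \<open>Q\<close> below the infimum. The
      denominator \<open>n + 1\<close> is positive without a separate argument that \<open>w\<close>
      is nonzero.\<close>
    define c n s where "c = z \<bullet> w - \<phi> w" and "n = (norm w)\<^sup>2" and "s = - c / (n + 1)"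
    assume "\<phi> w \<noteq> z \<bullet> w"
    then have c: "c \<noteq> 0" by (simp add: c_def)
    have n: "n \<ge> 0" by (simp add: n_def)
    have "Q (z + s *\<^sub>R w) = Q z + 2 * s * c + s\<^sup>2 * n"
      unfolding Q_def c_def n_def power2_norm_eq_inner \<phi>.scale \<phi>.add
      by (simp add: algebra_simps inner_commute power2_eq_square)
    then have "0 \<le> 2 * s * c + s\<^sup>2 * n"
      using m_le[of "z + s *\<^sub>R w"] \<open>Q z \<le> m\<close> by linarith
    moreover have c_eq: "c = - s * (n + 1)" using n by (simp add: s_def)
    have "2 * s * c + s\<^sup>2 * n = - (s\<^sup>2 * (n + 2))"
      unfolding c_eq by (simp add: algebra_simps power2_eq_square)
    moreover have "s\<^sup>2 * (n + 2) > 0" using c n by (simp add: s_def)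
    ultimately show False by simp
  qed
  then show ?thesis by blast
qed

text \<open>Filters replace subsequences: this needs neither separability nor a diagonal argument,
  since Tychonoff's theorem already gives a cluster point of the functionals \<open>w \<mapsto> X k \<bullet> w\<close>.\<close>

lemma bounded_imp_weak_cluster_point:
  fixes X :: "'b \<Rightarrow> 'a::{real_inner, complete_space}"
  assumes bound: "\<And>k. norm (X k) \<le> B" and F: "F \<noteq> bot"
  obtains G z where "G \<le> F" "G \<noteq> bot" "\<And>w. ((\<lambda>k. X k \<bullet> w) \<longlongrightarrow> z \<bullet> w) G"
proof -
  define \<Phi> where "\<Phi> k = (\<lambda>w. X k \<bullet> w)" for k
  \<comment> \<open>By Cauchy-Schwarz every functional \<open>\<Phi> k\<close> lies in this product
    of compact intervals.\<close>
  define S where "S = PiE UNIV (\<lambda>w::'a. cball (0::real) (B * norm w))"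
  have "compactin (product_topology (\<lambda>i. euclidean) UNIV) S"
    unfolding S_def compactin_PiE by simp
  then have "compact S"
    by (simp add: euclidean_product_topology)
  have mem: "\<Phi> k \<in> S" for k
  proof -
    have "\<bar>X k \<bullet> w\<bar> \<le> B * norm w" for w
      using Cauchy_Schwarz_ineq2[of "X k" w] mult_right_mono[OF bound[of k], of "norm w"] by simp
    then show ?thesis by (simp add: S_def \<Phi>_def PiE_iff)
  qed
  have "filtermap \<Phi> F \<noteq> bot" "\<forall>\<^sub>F u in filtermap \<Phi> F. u \<in> S"
    using F mem by (auto simp: filtermap_bot_iff eventually_filtermap)
  with \<open>compact S\<close> obtain l where "l \<in> S" and l: "inf (nhds l) (filtermap \<Phi> F) \<noteq> bot"
    unfolding compact_filter by blast
  \<comment> \<open>The analogue of passing to a subsequence: \<open>G\<close> refines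
    \<open>F\<close> just enough to make \<open>\<Phi>\<close> converge to \<open>l\<close>, and it
    stays proper because \<open>l\<close> is a cluster point.\<close>
  define G where "G = inf F (filtercomap \<Phi> (nhds l))"
  have "G \<noteq> bot"
  proof
    assume "G = bot"
    then obtain P Q where P: "eventually P F" and Q: "eventually Q (nhds l)"
      and PQ: "\<And>k. P k \<Longrightarrow> Q (\<Phi> k) \<Longrightarrow> False"
      unfolding G_def trivial_limit_def eventually_inf eventually_filtercomap by blast
    have "eventually (\<lambda>u. \<not> Q u) (filtermap \<Phi> F)"
      unfolding eventually_filtermap using P by (rule eventually_mono) (use PQ in blast)
    then have "inf (nhds l) (filtermap \<Phi> F) = bot"
      unfolding trivial_limit_def eventually_inf using Q by blast
    with l show False by contradiction
  qed
  have "filterlim \<Phi> (nhds l) G"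
    unfolding filterlim_def G_def filtermap_le_iff_le_filtercomap by simp
  then have lim: "((\<lambda>k. X k \<bullet> w) \<longlongrightarrow> l w) G" for w
    using continuous_on_tendsto_compose[OF continuous_on_product_coordinates, of \<Phi> l G w]
    by (simp add: \<Phi>_def)
  \<comment> \<open>Linearity passes to pointwise limits, and the norm bound is membership of
    \<open>l\<close> in \<open>S\<close>.\<close>
  have "bounded_linear l"
  proof (rule bounded_linear_intro)
    show "l (u + w) = l u + l w" for u w
      using tendsto_unique[OF \<open>G \<noteq> bot\<close> lim[of "u + w"]] tendsto_add[OF lim[of u] lim[of w]]
      by (simp add: inner_add_right)
    show "l (r *\<^sub>R w) = r *\<^sub>R l w" for r w
      using tendsto_unique[OF \<open>G \<noteq> bot\<close> lim[of "r *\<^sub>R w"]] tendsto_mult_left[OF lim[of w], of r]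
      by simp
    show "norm (l w) \<le> norm w * B" for w
      using \<open>l \<in> S\<close> by (auto simp: S_def PiE_iff mult.commute)
  qed
  then obtain z where "\<And>w. l w = z \<bullet> w" using riesz_representation by blast
  then show thesis using lim \<open>G \<noteq> bot\<close> by (intro that[of G z]) (auto simp: G_def)
qed

text \<open>An Opial-type argument: if \<open>z0\<close> and \<open>z1\<close> are weak cluster
  points, the limit of \<open>X k \<bullet> (z0 - z1)\<close> equals both
  \<open>z0 \<bullet> (z0 - z1)\<close> and \<open>z1 \<bullet> (z0 - z1)\<close>, so
  \<open>z0 = z1\<close>. Boundedness then turns uniqueness into convergence.\<close>

lemma weak_convergence_from_cluster_points:
  fixes X :: "nat \<Rightarrow> 'a::{real_inner, complete_space}"
  assumes bound: "\<And>k. norm (X k) \<le> B"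
    and cluster: "\<And>G z. G \<le> sequentially \<Longrightarrow> G \<noteq> bot \<Longrightarrow>
      (\<And>w. ((\<lambda>k. X k \<bullet> w) \<longlongrightarrow> z \<bullet> w) G) \<Longrightarrow> z \<in> S"
    and difference: "\<And>z z'. z \<in> S \<Longrightarrow> z' \<in> S \<Longrightarrow> convergent (\<lambda>k. X k \<bullet> (z - z'))"
  shows "\<exists>z\<in>S. \<forall>w. (\<lambda>k. X k \<bullet> w) \<longlonglongrightarrow> z \<bullet> w"
proof -
  obtain G0 z0 where G0: "G0 \<le> sequentially" "G0 \<noteq> bot"
    and z0: "\<And>w. ((\<lambda>k. X k \<bullet> w) \<longlongrightarrow> z0 \<bullet> w) G0"
    using bounded_imp_weak_cluster_point[of X B sequentially] bound by auto
  have "z0 \<in> S" using cluster G0 z0 by blast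
  have "(\<lambda>k. X k \<bullet> w) \<longlonglongrightarrow> z0 \<bullet> w" for w
  proof (rule ccontr)
    assume "\<not> (\<lambda>k. X k \<bullet> w) \<longlonglongrightarrow> z0 \<bullet> w"
    then obtain e where e: "e > 0"
      and nev: "\<not> eventually (\<lambda>k. dist (X k \<bullet> w) (z0 \<bullet> w) < e) sequentially"
      unfolding tendsto_iff by blast
    \<comment> \<open>Keeps only the indices that violate convergence against \<open>w\<close>. A
      cluster point along \<open>F\<close> must equal \<open>z0\<close>, yet along \<open>F\<close>
      the inner products stay at distance at least \<open>e\<close> from
      \<open>z0 \<bullet> w\<close>.\<close>
    define F where "F = inf sequentially (principal {k. dist (X k \<bullet> w) (z0 \<bullet> w) \<ge> e})"
    have "F \<noteq> bot"
      using nev unfolding F_def trivial_limit_def eventually_inf_principal by (simp add: not_le)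
    then obtain G1 z1 where G1: "G1 \<le> F" "G1 \<noteq> bot"
      and z1: "\<And>w. ((\<lambda>k. X k \<bullet> w) \<longlongrightarrow> z1 \<bullet> w) G1"
      using bounded_imp_weak_cluster_point[of X B F] bound by blast
    have G1': "G1 \<le> sequentially" using G1 by (simp add: F_def)
    have "z1 \<in> S" using cluster G1' G1 z1 by blast
    then obtain p where p: "(\<lambda>k. X k \<bullet> (z0 - z1)) \<longlonglongrightarrow> p"
      using difference[OF \<open>z0 \<in> S\<close>] by (auto simp: convergent_def)
    have "z0 \<bullet> (z0 - z1) = p"
      using tendsto_unique[OF G0(2) z0 tendsto_mono[OF G0(1) p]] .
    moreover have "z1 \<bullet> (z0 - z1) = p"
      using tendsto_unique[OF G1(2) z1 tendsto_mono[OF G1' p]] .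
    ultimately have "(z0 - z1) \<bullet> (z0 - z1) = 0" by (simp add: inner_diff_left)
    then have "z1 = z0" by simp
    have "eventually (\<lambda>k. dist (X k \<bullet> w) (z0 \<bullet> w) \<ge> e) F"
      unfolding F_def eventually_inf_principal by simp
    then have "eventually (\<lambda>k. dist (X k \<bullet> w) (z0 \<bullet> w) \<ge> e) G1"
      using G1(1) by (rule filter_leD[rotated])
    moreover have "eventually (\<lambda>k. dist (X k \<bullet> w) (z0 \<bullet> w) < e) G1"
      using tendstoD[OF z1[of w] e] \<open>z1 = z0\<close> by simp
    ultimately have "eventually (\<lambda>k. False) G1" by eventually_elim simp
    with G1(2) show False by (simp add: trivial_limit_def)
  qed
  with \<open>z0 \<in> S\<close> show ?thesis by blast
qed

section \<open>Smooth convex functions\<close>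

lemma GDERIV_along_line:
  fixes u d :: "'a::real_inner"
  assumes "\<And>z. GDERIV f z :> g z"
  shows "((\<lambda>s. f (u + s *\<^sub>R d)) has_real_derivative g (u + s *\<^sub>R d) \<bullet> d) (at s)"
proof -
  have "((\<lambda>s. u + s *\<^sub>R d) has_derivative (\<lambda>r. r *\<^sub>R d)) (at s)"
    by (auto intro!: derivative_eq_intros)
  moreover have "(f has_derivative (\<lambda>h. h \<bullet> g (u + s *\<^sub>R d))) (at (u + s *\<^sub>R d))"
    using assms by (simp add: gderiv_def)
  ultimately have "((\<lambda>s. f (u + s *\<^sub>R d)) has_derivative (\<lambda>r. (r *\<^sub>R d) \<bullet> g (u + s *\<^sub>R d))) (at s)"
    by (rule has_derivative_compose)
  then show ?thesis
    unfolding has_field_derivative_def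
    by (rule has_derivative_eq_rhs) (simp add: fun_eq_iff inner_commute)
qed

lemma convex_on_imp_above_gradient:
  fixes f :: "'a::real_inner \<Rightarrow> real"
  assumes convex: "convex_on UNIV f" and gradient: "\<And>z. GDERIV f z :> g z"
  shows "f u + g u \<bullet> (v - u) \<le> f v"
proof -
  have "convex_on UNIV (\<lambda>s::real. f (u + s *\<^sub>R (v - u)))"
  proof (rule convex_onI)
    fix r a b :: real assume r: "0 < r" "r < 1"
    have "u + ((1 - r) *\<^sub>R a + r *\<^sub>R b) *\<^sub>R (v - u) =
        (1 - r) *\<^sub>R (u + a *\<^sub>R (v - u)) + r *\<^sub>R (u + b *\<^sub>R (v - u))"
      by (simp add: algebra_simps)
    then show "f (u + ((1 - r) *\<^sub>R a + r *\<^sub>R b) *\<^sub>R (v - u)) \<le>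
        (1 - r) * f (u + a *\<^sub>R (v - u)) + r * f (u + b *\<^sub>R (v - u))"
      using convex_onD[OF convex, of r "u + a *\<^sub>R (v - u)" "u + b *\<^sub>R (v - u)"] r by simp
  qed auto
  from convex_on_imp_above_tangent[OF this, of 0 1] GDERIV_along_line[of f g u "v - u" 0] gradient
  have "f v - f u \<ge> g u \<bullet> (v - u)" by (auto simp: connected_UNIV)
  then show ?thesis by linarith
qed

text \<open>Along the segment from \<open>u\<close> to \<open>v\<close>, the excess
  \<open>\<psi>\<close> over the quadratic model is nonincreasing: Cauchy-Schwarz and the Lipschitz
  bound give a derivative at most 0.\<close>

lemma descent_lemma:
  fixes f :: "'a::real_inner \<Rightarrow> real"
  assumes gradient: "\<And>z. GDERIV f z :> g z" and lipschitz: "L-lipschitz_on UNIV g"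
  shows "f v \<le> f u + g u \<bullet> (v - u) + L / 2 * (norm (v - u))\<^sup>2"
proof -
  define d where "d = v - u"
  define \<psi> where "\<psi> s = f (u + s *\<^sub>R d) - s * (g u \<bullet> d) - L / 2 * s\<^sup>2 * (norm d)\<^sup>2" for s
  have "\<psi> 1 \<le> \<psi> 0"
  proof (rule DERIV_nonpos_imp_nonincreasing[of 0 1 \<psi>])
    fix s :: real assume s: "0 \<le> s" "s \<le> 1"
    have "(\<psi> has_real_derivative
        g (u + s *\<^sub>R d) \<bullet> d - g u \<bullet> d - L * s * (norm d)\<^sup>2) (at s)"
      unfolding \<psi>_def
      by (auto intro!: derivative_eq_intros GDERIV_along_line[OF gradient])
    moreover have "g (u + s *\<^sub>R d) \<bullet> d - g u \<bullet> d - L * s * (norm d)\<^sup>2 \<le> 0"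
    proof -
      have "(g (u + s *\<^sub>R d) - g u) \<bullet> d \<le> norm (g (u + s *\<^sub>R d) - g u) * norm d"
        by (rule norm_cauchy_schwarz)
      also have "\<dots> \<le> (L * (s * norm d)) * norm d"
        using lipschitz_onD[OF lipschitz, of "u + s *\<^sub>R d" u] s
        by (intro mult_right_mono) (auto simp: dist_norm)
      finally show ?thesis by (simp add: inner_diff_left power2_eq_square mult.assoc)
    qed
    ultimately show "\<exists>D. (\<psi> has_real_derivative D) (at s) \<and> D \<le> 0" by blast
  qed simp
  then show ?thesis by (simp add: \<psi>_def d_def)
qed

text \<open>Descent from \<open>y\<close> to \<open>p\<close> gains
  \<open>lam / 2 * (norm (g y))\<^sup>2\<close> since \<open>L * lam \<le> 1\<close>; convexity
  compares \<open>f y\<close> with \<open>f u\<close>. The sum of the two bounds is exactly a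
  difference of squared distances.\<close>

lemma gradient_step_inequality:
  fixes f :: "'a::real_inner \<Rightarrow> real"
  assumes convex: "convex_on UNIV f" and gradient: "\<And>z. GDERIV f z :> g z"
    and lipschitz: "L-lipschitz_on UNIV g" and L: "L > 0" and lam: "0 < lam" "lam \<le> 1 / L"
    and p: "p = y - lam *\<^sub>R g y"
  shows "2 * lam * (f p - f u) \<le> (norm (y - u))\<^sup>2 - (norm (p - u))\<^sup>2"
proof -
  have "L * lam \<le> 1" using L lam by (simp add: field_simps)
  then have "(L * lam) * (lam * (norm (g y))\<^sup>2) \<le> 1 * (lam * (norm (g y))\<^sup>2)"
    using lam by (intro mult_right_mono) auto
  moreover have "f p \<le> f y - lam * (norm (g y))\<^sup>2 + L / 2 * (lam\<^sup>2 * (norm (g y))\<^sup>2)"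
    using descent_lemma[OF gradient lipschitz, of p y]
    by (simp add: p power_mult_distrib flip: power2_norm_eq_inner)
  ultimately have "f p \<le> f y - lam / 2 * (norm (g y))\<^sup>2"
    by (simp add: power2_eq_square)
  moreover have "f y \<le> f u + g y \<bullet> (y - u)"
    using convex_on_imp_above_gradient[OF convex gradient, of y u] by (simp add: inner_diff_right)
  ultimately have "2 * lam * (f p - f u) \<le> 2 * lam * (g y \<bullet> (y - u) - lam / 2 * (norm (g y))\<^sup>2)"
    using lam by (intro mult_left_mono) auto
  also have "\<dots> = (norm (y - u))\<^sup>2 - (norm (p - u))\<^sup>2"
    unfolding p power2_norm_eq_inner
    by (simp add: algebra_simps inner_commute power2_eq_square)
  finally show ?thesis .
qed

section \<open>Energy and averages\<close>

text \<open>Here \<open>s\<close>, \<open>T\<close> stand for consecutive step sizes and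
  \<open>x'\<close>, \<open>x\<close>, \<open>p\<close> for consecutive iterates. The gradient step
  inequality is used at a convex combination of \<open>x\<close> and \<open>z\<close>, then
  multiplied by \<open>T\<^sup>2\<close>.\<close>

lemma energy_step:
  fixes f :: "'a::real_inner \<Rightarrow> real"
  assumes convex: "convex_on UNIV f" and gradient: "\<And>z. GDERIV f z :> g z"
    and lipschitz: "L-lipschitz_on UNIV g" and L: "L > 0" and lam: "0 < lam" "lam \<le> 1 / L"
    and T: "T \<ge> 1" "T\<^sup>2 - T \<le> s\<^sup>2"
    and z: "f z \<le> f x"
    and y: "y = x + ((s - 1) / T) *\<^sub>R (x - x')" and p: "p = y - lam *\<^sub>R g y"
  shows "2 * lam * T\<^sup>2 * (f p - f z) + (norm (T *\<^sub>R p - (T - 1) *\<^sub>R x - z))\<^sup>2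
    \<le> 2 * lam * s\<^sup>2 * (f x - f z) + (norm (s *\<^sub>R x - (s - 1) *\<^sub>R x' - z))\<^sup>2"
proof -
  \<comment> \<open>Weight \<open>1 / T\<close> on \<open>z\<close> makes
    \<open>T *\<^sub>R (p - u)\<close> the vector inside the new energy.\<close>
  define u where "u = (1 - 1 / T) *\<^sub>R x + (1 / T) *\<^sub>R z"
  have T0: "T \<noteq> 0" using T by simp
  have "f u \<le> (1 - 1 / T) * f x + (1 / T) * f z"
    unfolding u_def using T by (intro convex_onD[OF convex]) auto
  then have "T * f u \<le> T * ((1 - 1 / T) * f x + (1 / T) * f z)"
    using T by (intro mult_left_mono) auto
  also have "\<dots> = (T - 1) * f x + f z" using T0 by (simp add: field_simps)
  finally have fu: "T * (T * f u) \<le> T * ((T - 1) * f x + f z)"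
    using T by (intro mult_left_mono) auto
  have scale: "T\<^sup>2 * (norm (w - u))\<^sup>2 = (norm (T *\<^sub>R w - (T - 1) *\<^sub>R x - z))\<^sup>2" for w
  proof -
    have "T *\<^sub>R (w - u) = T *\<^sub>R w - (T - 1) *\<^sub>R x - z"
      using T0 by (simp add: u_def algebra_simps)
    then show ?thesis by (metis norm_scaleR power2_abs power_mult_distrib)
  qed
  \<comment> \<open>The momentum coefficient \<open>(s - 1) / T\<close> is what turns
    \<open>T *\<^sub>R (y - u)\<close> into the vector of the old energy.\<close>
  have Ty: "T *\<^sub>R y - (T - 1) *\<^sub>R x = s *\<^sub>R x - (s - 1) *\<^sub>R x'"
    using T0 by (simp add: y scaleR_right_distrib) (simp add: algebra_simps)
  have "T\<^sup>2 * (2 * lam * (f p - f u)) \<le> T\<^sup>2 * ((norm (y - u))\<^sup>2 - (norm (p - u))\<^sup>2)"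
    using gradient_step_inequality[OF convex gradient lipschitz L lam p]
    by (intro mult_left_mono) auto
  also have "\<dots> = (norm (s *\<^sub>R x - (s - 1) *\<^sub>R x' - z))\<^sup>2 -
      (norm (T *\<^sub>R p - (T - 1) *\<^sub>R x - z))\<^sup>2"
    unfolding right_diff_distrib scale Ty ..
  finally have A: "2 * lam * (T\<^sup>2 * f p - T\<^sup>2 * f u) \<le> \<dots>" by (simp add: algebra_simps)
  have "(T\<^sup>2 - T) * (f x - f z) \<le> s\<^sup>2 * (f x - f z)"
    using T z by (intro mult_right_mono) auto
  then have "T\<^sup>2 * (f p - f z) - s\<^sup>2 * (f x - f z) \<le> T\<^sup>2 * f p - T\<^sup>2 * f u"
    using fu by (simp add: algebra_simps power2_eq_square)
  then have "2 * lam * (T\<^sup>2 * (f p - f z) - s\<^sup>2 * (f x - f z)) \<le> 2 * lam * (T\<^sup>2 * f p - T\<^sup>2 * f u)"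
    using lam by (intro mult_left_mono) auto
  with A show ?thesis by (simp add: algebra_simps)
qed

text \<open>Read as \<open>h k = (1 - 1 / t k) * h (k - 1) + (1 / t k) * p\<^sub>k\<close> with \<open>p\<^sub>k \<longlonglongrightarrow> p\<close>:
  the weights \<open>1 / t k \<ge> 1 / k\<close> have a divergent sum, so the initial values are forgotten.\<close>

lemma averaging_limit:
  fixes h t :: "nat \<Rightarrow> real"
  assumes t: "\<And>k. k \<ge> 1 \<Longrightarrow> 1 \<le> t k" "\<And>k. k \<ge> 1 \<Longrightarrow> t k \<le> real k"
    and lim: "(\<lambda>k. t k * h k - (t k - 1) * h (k - 1)) \<longlonglongrightarrow> p"
  shows "h \<longlonglongrightarrow> p"
proof (rule LIMSEQ_I)
  fix r :: real assume "r > 0"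
  define e where "e = r / 2"
  have e: "e > 0" using \<open>r > 0\<close> by (simp add: e_def)
  obtain N0 where N0: "\<And>k. k \<ge> N0 \<Longrightarrow> \<bar>t k * h k - (t k - 1) * h (k - 1) - p\<bar> < e"
    using LIMSEQ_D[OF lim e] by auto
  define N where "N = max 1 N0"
  \<comment> \<open>The part of the error exceeding the tolerance \<open>e\<close>. Truncation at 0
    removes the inhomogeneous term of the recursion, and \<open>real k * c k\<close> becomes
    nonincreasing from \<open>N\<close> on.\<close>
  define c where "c k = max 0 (\<bar>h k - p\<bar> - e)" for k
  have step: "real (Suc k) * c (Suc k) \<le> real k * c k" if "k \<ge> N" for k
  proof -
    define T where "T = t (Suc k)"
    have T: "1 \<le> T" "T \<le> real (Suc k)" using t[of "Suc k"] by (auto simp: T_def)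
    have c0: "c k \<ge> 0" "\<bar>h k - p\<bar> - e \<le> c k" by (auto simp: c_def)
    have "T * (h (Suc k) - p) = (T - 1) * (h k - p) + (T * h (Suc k) - (T - 1) * h k - p)"
      by (simp add: algebra_simps)
    also have "\<bar>\<dots>\<bar> \<le> \<bar>(T - 1) * (h k - p)\<bar> + \<bar>T * h (Suc k) - (T - 1) * h k - p\<bar>"
      by (rule abs_triangle_ineq)
    also have "\<dots> \<le> (T - 1) * \<bar>h k - p\<bar> + e"
      using N0[of "Suc k"] that T by (auto simp: T_def N_def abs_mult)
    finally have "T * \<bar>h (Suc k) - p\<bar> \<le> (T - 1) * \<bar>h k - p\<bar> + e"
      using T by (simp add: abs_mult)
    then have "T * (\<bar>h (Suc k) - p\<bar> - e) \<le> (T - 1) * (\<bar>h k - p\<bar> - e)"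
      by (simp add: algebra_simps)
    also have "\<dots> \<le> (T - 1) * c k" using T c0 by (intro mult_left_mono) auto
    finally have "T * c (Suc k) \<le> (T - 1) * c k"
      using T c0 by (simp add: c_def[of "Suc k"] max_def)
    then have 1: "c (Suc k) \<le> (1 - 1 / T) * c k"
      using T by (simp add: field_simps)
    \<comment> \<open>The bound \<open>t k \<le> real k\<close> enters here: the contraction factor
      is at most \<open>k / (k + 1)\<close>, whose products telescope.\<close>
    have "1 - 1 / T \<le> 1 - 1 / real (Suc k)"
      using T by (simp add: frac_le)
    then have "c (Suc k) \<le> (1 - 1 / real (Suc k)) * c k"
      using 1 mult_right_mono[OF _ c0(1)] order_trans by blast
    then show ?thesis by (simp add: field_simps)
  qed
  define K where "K = real N * c N"
  have K: "real k * c k \<le> K" if "k \<ge> N" for k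
    using that
  proof (induction k rule: dec_induct)
    case (step k)
    then show ?case using \<open>\<And>k. k \<ge> N \<Longrightarrow> real (Suc k) * c (Suc k) \<le> real k * c k\<close>[of k] by linarith
  qed (simp add: K_def)
  obtain M :: nat where M: "K / e < real M" using reals_Archimedean2 by blast
  have "norm (h k - p) < r" if k: "k \<ge> max M N" for k
  proof -
    have k1: "real k > 0" using k by (auto simp: N_def)
    have "K < e * real M" using M e by (simp add: field_simps)
    also have "\<dots> \<le> e * real k" using k e by simp
    finally have "real k * c k < real k * e" using K[of k] k by (simp add: mult.commute)
    then have "c k < e" using k1 by simp
    moreover have "\<bar>h k - p\<bar> - e \<le> c k" by (simp add: c_def)
    ultimately show ?thesis by (simp add: e_def)
  qed
  then show "\<exists>no. \<forall>n\<ge>no. norm (h n - p) < r" by blast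
qed

text \<open>Dividing the recursion by \<open>t (k + 1) + t k\<close> puts each increment between
  \<open>(1 - \<theta>) / 2\<close> and 1, so growth is linear; \<theta> < 1 makes the lower rate
  positive.\<close>

lemma step_sizes_bounds:
  fixes t :: "nat \<Rightarrow> real"
  assumes theta: "0 \<le> \<theta>" "\<theta> < 1"
    and t_pos: "\<And>k. k \<ge> 1 \<Longrightarrow> t k > 0" and t_1: "t 1 = 1"
    and t_step: "\<And>k. k \<ge> 1 \<Longrightarrow> (t (k + 1))\<^sup>2 - (t k)\<^sup>2 = (1 - \<theta>) * t (k + 1) + \<theta> * t k"
  shows "k \<ge> 1 \<Longrightarrow> 1 \<le> t k \<and> t k \<le> real k"
    and "k \<ge> 1 \<Longrightarrow> (t (k + 1))\<^sup>2 - t (k + 1) \<le> (t k)\<^sup>2"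
    and "filterlim t at_top sequentially"
proof -
  have inc: "t k + (1 - \<theta>) / 2 \<le> t (k + 1) \<and> t (k + 1) \<le> t k + 1" if "k \<ge> 1" for k
  proof -
    define a b where "a = t k" and "b = t (k + 1)"
    have ab: "a > 0" "b > 0" using t_pos that by (auto simp: a_def b_def)
    have eq: "(b - a) * (b + a) = (1 - \<theta>) * b + \<theta> * a"
      using t_step[OF that] by (simp add: a_def b_def algebra_simps power2_eq_square)
    moreover have "(1 - \<theta>) * b + \<theta> * a > 0"
      using theta ab by (intro add_pos_nonneg) auto
    ultimately have "b > a" using ab by (metis add_pos_pos diff_gt_0_iff_gt zero_less_mult_pos2)
    have "(1 - \<theta>) * a \<le> (1 - \<theta>) * b" "0 \<le> \<theta> * a" "0 \<le> \<theta> * b" "\<theta> * b \<le> 1 * b" "\<theta> * a \<le> 1 * a"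
      using theta ab \<open>b > a\<close> by (auto intro: mult_left_mono mult_right_mono)
    then have "(1 - \<theta>) / 2 * (b + a) \<le> (b - a) * (b + a)" "(b - a) * (b + a) \<le> 1 * (b + a)"
      unfolding eq by (simp_all add: field_simps)
    then have "(1 - \<theta>) / 2 \<le> b - a" "b - a \<le> 1"
      using ab by (auto dest: mult_right_le_imp_le)
    then show ?thesis by (simp add: a_def b_def field_simps)
  qed
  have lower: "1 + (real k - 1) * ((1 - \<theta>) / 2) \<le> t k" if "k \<ge> 1" for k
    using that
  proof (induction k rule: dec_induct)
    case (step k)
    then show ?case using inc[of k] by (simp add: field_simps)
  qed (use t_1 in simp)
  have upper: "t k \<le> real k" if "k \<ge> 1" for k
    using that
  proof (induction k rule: dec_induct)
    case (step k)
    then show ?case using inc[of k] by simp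
  qed (use t_1 in simp)
  have "1 \<le> t k" if "k \<ge> 1" for k
  proof -
    have "0 \<le> (real k - 1) * ((1 - \<theta>) / 2)" using theta that by simp
    with lower[OF that] show ?thesis by linarith
  qed
  with upper show "k \<ge> 1 \<Longrightarrow> 1 \<le> t k \<and> t k \<le> real k" by blast
  show "(t (k + 1))\<^sup>2 - t (k + 1) \<le> (t k)\<^sup>2" if "k \<ge> 1"
  proof -
    have "t k \<le> t (k + 1)" using theta inc[OF that] by (simp add: field_simps)
    then have "\<theta> * t k \<le> \<theta> * t (k + 1)" using theta by (intro mult_left_mono)
    with t_step[OF that] show ?thesis by (simp add: algebra_simps)
  qed
  have "filterlim (\<lambda>k. 1 + (real k - 1) * ((1 - \<theta>) / 2)) at_top sequentially"
    using theta by real_asymp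
  then show "filterlim t at_top sequentially"
    by (rule filterlim_at_top_mono) (use lower in \<open>auto intro: eventually_sequentiallyI[of 1]\<close>)
qed

section \<open>Weak convergence of the iterates\<close>

theorem theorem1:
  fixes f :: "'a::{real_inner, complete_space} \<Rightarrow> real"
    and gradf :: "'a \<Rightarrow> 'a"
    and L \<theta> lam :: real
    and t \<alpha> :: "nat \<Rightarrow> real"
    and x y :: "nat \<Rightarrow> 'a"
  assumes convex: "convex_on UNIV f"
    and gradient: "\<And>z. GDERIV f z :> gradf z"
    and continuous_gradient: "continuous_on UNIV gradf"
    and L_pos: "L > 0"
    and lipschitz_gradient: "L-lipschitz_on UNIV gradf"
    and minimizer_exists: "argmin f \<noteq> {}"
    and theta: "0 \<le> \<theta>" "\<theta> < 1"
    and t_pos: "\<And>k. k \<ge> 1 \<Longrightarrow> t k > 0"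
    and t_1: "t 1 = 1"
    and t_step: "\<And>k. k \<ge> 1 \<Longrightarrow>
      (t (k + 1))\<^sup>2 - (t k)\<^sup>2 = (1 - \<theta>) * t (k + 1) + \<theta> * t k"
    and lam: "0 < lam" "lam \<le> 1 / L"
    and alpha: "\<And>k. k \<ge> 1 \<Longrightarrow> \<alpha> k = (t k - 1) / t (k + 1)"
    and y_step: "\<And>k. k \<ge> 1 \<Longrightarrow> y k = x k + \<alpha> k *\<^sub>R (x k - x (k - 1))"
    and x_step: "\<And>k. k \<ge> 1 \<Longrightarrow> x (k + 1) = y k - lam *\<^sub>R gradf (y k)"
  shows "\<exists>xstar\<in>argmin f. \<forall>w. (\<lambda>k. x k \<bullet> w) \<longlonglongrightarrow> xstar \<bullet> w"
proof -
  have t_ge: "1 \<le> t k" and t_le: "t k \<le> real k"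
    and t_square: "(t (k + 1))\<^sup>2 - t (k + 1) \<le> (t k)\<^sup>2" if "k \<ge> 1" for k
    using step_sizes_bounds(1,2)[OF theta, of t k] t_pos t_1 t_step that by auto
  have t_at_top: "filterlim t at_top sequentially"
    by (rule step_sizes_bounds(3)[OF theta]) (use t_pos t_1 t_step in auto)
  obtain z0 where z0: "z0 \<in> argmin f" using minimizer_exists by blast
  define v where "v k = t k *\<^sub>R x k - (t k - 1) *\<^sub>R x (k - 1)" for k
  define E where "E z k = 2 * lam * (t k)\<^sup>2 * (f (x k) - f z) + (norm (v k - z))\<^sup>2" for z k
  have E_dec: "E z (Suc k) \<le> E z k" if "z \<in> argmin f" "k \<ge> 1" for z k
    unfolding E_def v_def
    using energy_step[OF convex gradient lipschitz_gradient L_pos lam _ t_square[OF that(2)] _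
        y_step[OF that(2), unfolded alpha[OF that(2)]] x_step[OF that(2)], of z]
      that t_ge[of "k + 1"] by (auto simp: argmin_iff)
  have gap: "0 \<le> 2 * lam * (t k)\<^sup>2 * (f (x k) - f z)" if "z \<in> argmin f" for z k
    using that lam by (simp add: argmin_iff)
  have E_nonneg: "0 \<le> E z k" if "z \<in> argmin f" for z k
    using gap[OF that] by (simp add: E_def)
  have E_le: "E z k \<le> E z 1" if "z \<in> argmin f" "k \<ge> 1" for z k
    using that(2)
  proof (induction k rule: dec_induct)
    case (step k)
    then show ?case using E_dec[OF that(1), of k] by linarith
  qed simp
  have E_conv: "convergent (E z)" if z: "z \<in> argmin f" for z
  proof -
    \<comment> \<open>The shift skips index 0, where \<open>t 0\<close> is unconstrained and
      \<open>k - 1\<close> truncates to 0.\<close>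
    have "decseq (\<lambda>k. E z (Suc k))" using E_dec[OF z] by (intro decseq_SucI) simp
    then obtain l where "(\<lambda>k. E z (Suc k)) \<longlonglongrightarrow> l"
      using decseq_convergent[of "\<lambda>k. E z (Suc k)" 0] E_nonneg[OF z] by blast
    then show ?thesis unfolding convergent_def using LIMSEQ_imp_Suc by blast
  qed

  have "\<exists>B. \<forall>k. norm (x k) \<le> B"
  proof -
    \<comment> \<open>The second term starts the induction at \<open>x 0\<close>. Each later
      \<open>x (Suc k) - z0\<close> is a convex combination of \<open>x k - z0\<close> and
      \<open>v (Suc k) - z0\<close>, so the ball of radius \<open>R\<close> is never left.\<close>
    define R where "R = max (sqrt (E z0 1)) (norm (x 0 - z0))"
    have v_le: "norm (v k - z0) \<le> R" if "k \<ge> 1" for k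
    proof -
      have "(norm (v k - z0))\<^sup>2 \<le> E z0 1"
        using E_le[OF z0 that] gap[OF z0, of k] unfolding E_def[of z0 k] by linarith
      then show ?thesis by (simp add: R_def le_max_iff_disj real_le_rsqrt)
    qed
    have "norm (x k - z0) \<le> R" for k
    proof (induction k)
      case (Suc k)
      define T where "T = t (Suc k)"
      have T: "T \<ge> 1" using t_ge[of "Suc k"] by (simp add: T_def)
      have "T *\<^sub>R (x (Suc k) - z0) = (T - 1) *\<^sub>R (x k - z0) + (v (Suc k) - z0)"
        by (simp add: v_def T_def algebra_simps)
      then have "T * norm (x (Suc k) - z0) = norm ((T - 1) *\<^sub>R (x k - z0) + (v (Suc k) - z0))"
        using T by (metis abs_of_nonneg norm_scaleR order_trans zero_le_one)
      also have "\<dots> \<le> norm ((T - 1) *\<^sub>R (x k - z0)) + norm (v (Suc k) - z0)"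
        by (rule norm_triangle_ineq)
      also have "\<dots> \<le> (T - 1) * R + R"
        using T Suc v_le[of "Suc k"] by (intro add_mono) (auto intro: mult_left_mono)
      also have "\<dots> = T * R" by (simp add: algebra_simps)
      finally show ?case using T by simp
    qed (simp add: R_def)
    then have "norm (x k) \<le> R + norm z0" for k
      using norm_triangle_sub[of "x k" z0] by (smt (verit))
    then show ?thesis by blast
  qed
  then obtain B where B: "\<And>k. norm (x k) \<le> B" by blast

  have f_lim: "(\<lambda>k. f (x k)) \<longlonglongrightarrow> f z0"
  proof -
    have "(\<lambda>k. E z0 1 / (2 * lam) * inverse ((t k)\<^sup>2)) \<longlonglongrightarrow> E z0 1 / (2 * lam) * 0"
      using t_at_top
      by (intro tendsto_intros tendsto_inverse_0_at_top filterlim_pow_at_top) auto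
    \<comment> \<open>Dropping the squared norm from the energy leaves a gap of order
      \<open>1 / (t k)\<^sup>2\<close>.\<close>
    moreover have "eventually (\<lambda>k. f (x k) - f z0 \<le> E z0 1 / (2 * lam) * inverse ((t k)\<^sup>2)) sequentially"
    proof (rule eventually_sequentiallyI)
      fix k :: nat assume k: "k \<ge> 1"
      have "2 * lam * (t k)\<^sup>2 * (f (x k) - f z0) \<le> E z0 1"
        using E_le[OF z0 k] zero_le_power2[of "norm (v k - z0)"] unfolding E_def[of z0 k] by linarith
      then show "f (x k) - f z0 \<le> E z0 1 / (2 * lam) * inverse ((t k)\<^sup>2)"
        using lam t_pos[OF k] by (simp add: field_simps)
    qed
    ultimately have "(\<lambda>k. f (x k) - f z0) \<longlonglongrightarrow> 0"
      using z0 by (intro tendsto_sandwich[of "\<lambda>_. 0" "\<lambda>k. f (x k) - f z0"]) (auto simp: argmin_iff)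
    then show ?thesis by (simp add: LIM_zero_iff)
  qed

  show ?thesis
  proof (rule weak_convergence_from_cluster_points)
    show "norm (x k) \<le> B" for k by (rule B)
  next
    fix G z
    assume G: "G \<le> sequentially" "G \<noteq> bot" and lim: "\<And>w. ((\<lambda>k. x k \<bullet> w) \<longlongrightarrow> z \<bullet> w) G"
    \<comment> \<open>Weak lower semicontinuity by hand: the tangent of \<open>f\<close> at
      \<open>z\<close> is a minorant whose values at \<open>x k\<close> converge along
      \<open>G\<close> to \<open>f z\<close>.\<close>
    have "((\<lambda>k. f z + (x k \<bullet> gradf z - z \<bullet> gradf z)) \<longlongrightarrow> f z + (z \<bullet> gradf z - z \<bullet> gradf z)) G"
      by (intro tendsto_intros lim)
    moreover have "f z + (x k \<bullet> gradf z - z \<bullet> gradf z) \<le> f (x k)" for k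
      using convex_on_imp_above_gradient[OF convex gradient, of z "x k"]
      by (simp add: inner_diff_right inner_commute)
    ultimately have "f z \<le> f z0"
      using tendsto_le[OF G(2) tendsto_mono[OF G(1) f_lim]] by simp
    then show "z \<in> argmin f" using z0 order_trans by (fastforce simp: argmin_iff)
  next
    fix z z' assume z: "z \<in> argmin f" "z' \<in> argmin f"
    then have "f z = f z'" by (meson antisym argmin_iff)
    obtain a b where ab: "E z \<longlonglongrightarrow> a" "E z' \<longlonglongrightarrow> b"
      using E_conv z by (meson convergent_def)
    \<comment> \<open>With \<open>f z = f z'\<close> the function terms cancel, and so does
      \<open>(norm (v k))\<^sup>2\<close> after expanding; only a term linear in \<open>v k\<close>
      and constants remain.\<close>
    have "v k \<bullet> (z - z') = (E z' k - E z k + (norm z)\<^sup>2 - (norm z')\<^sup>2) / 2" for k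
      unfolding E_def \<open>f z = f z'\<close> power2_norm_eq_inner
      by (simp add: algebra_simps inner_commute)
    moreover have "(\<lambda>k. (E z' k - E z k + (norm z)\<^sup>2 - (norm z')\<^sup>2) / 2)
        \<longlonglongrightarrow> (b - a + (norm z)\<^sup>2 - (norm z')\<^sup>2) / 2"
      by (intro tendsto_intros ab) auto
    ultimately have "(\<lambda>k. v k \<bullet> (z - z')) \<longlonglongrightarrow> (b - a + (norm z)\<^sup>2 - (norm z')\<^sup>2) / 2"
      by (simp only:)
    then have "(\<lambda>k. t k * (x k \<bullet> (z - z')) - (t k - 1) * (x (k - 1) \<bullet> (z - z')))
        \<longlonglongrightarrow> (b - a + (norm z)\<^sup>2 - (norm z')\<^sup>2) / 2"
      unfolding v_def by (simp only: inner_diff_left inner_scaleR_left)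
    then show "convergent (\<lambda>k. x k \<bullet> (z - z'))"
      unfolding convergent_def using averaging_limit[of t "\<lambda>k. x k \<bullet> (z - z')"] t_ge t_le by blast
  qed
qed

end
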